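(* The natural map from parabolic $\mathbb Q$-lattices to $\mathbb Q$-lattices up to scale $$\theta:\ P^+(\mathbb Z)\backslash\big(\overline{P(\hat{\mathbb Z})}\times P^+(\mathbb R)\big)\longrightarrow\Gamma\backslash\big(M_2(\hat{\mathbb Z})\times GL_2^+(\mathbb R)\big)/\mathbb C^\times,\qquad \Gamma=SL_2(\mathbb Z),$$ induced by the inclusions, is injective except when the parabolic $\mathbb Q$-lattices are degenerate. Furthermore, the following formula defines a free action of $\mathbb Z$ on the degenerate parabolic $\mathbb Q$-lattices, whose orbits are the fibers of the map $\theta$ (on the degenerate parabolic $\mathbb Q$-lattices): $$\tau(c)(p,\alpha)=(p,t_c(\alpha)),\qquad t_c(\alpha)=\begin{pmatrix}1&0\\c&1\end{pmatrix}\alpha\,(1+c\bar z)^{-1}\qquad\forall c\in\mathbb Z .$$ Here $p=\begin{pmatrix}0&0\\0&1\end{pmatrix}\in\overline{P(\hat{\mathbb Z})}$, $\alpha=\begin{pmatrix} y&x\\0&1\end{pmatrix}\in P^+(\mathbb R)$, and $z=x+iy\in\mathbb C$.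
   Context: For a commutative ring $R$, $\overline{P(R)}=\left\{\begin{pmatrix} a&b\\0&1\end{pmatrix}: a,b\in R\right\}\subset M_2(R)$, $P(R)$ is the group of those matrices with $a$ invertible, and for a subring $R$ of $\mathbb R$, $P^+(R)$ is the subgroup of $P(R)$ with $a>0$. $P^+(\mathbb Z)=\left\{\begin{pmatrix}1&n\\0&1\end{pmatrix}\right\}$ and $\Gamma$ act diagonally by left multiplication. $\mathbb C^\times\subset GL_2^+(\mathbb R)$ via $a+ib\mapsto\begin{pmatrix} a&b\\-b&a\end{pmatrix}$, acting by right multiplication on $GL_2^+(\mathbb R)$; in the formula for $t_c(\alpha)$, the complex number $1+c\bar z$ is viewed as such a matrix. The space of two-dimensional $\mathbb Q$-lattices (pairs $(\Lambda,\phi)$ with $\Lambda\subset\mathbb C$ a lattice and $\phi:\mathbb Q^2/\mathbb Z^2\to\mathbb Q\Lambda/\Lambda$ a homomorphism) is identified with $\Gamma\backslash(M_2(\hat{\mathbb Z})\times GL_2^+(\mathbb R))$, $(\rho,\alpha)\mapsto(\alpha^{-1}\Lambda_0,\alpha^{-1}\rho)$, where $\Lambda_0=\mathbb Ze_1+\mathbb Ze_2$, $e_1=1$, $e_2=-i$; parabolic $\mathbb Q$-lattices are those with a representative $(\rho,\alpha)\in\overline{P(\hat{\mathbb Z})}\times P^+(\mathbb R)$, and they form the space $P^+(\mathbb Z)\backslash(\overline{P(\hat{\mathbb Z})}\times P^+(\mathbb R))$. A parabolic $\mathbb Q$-lattice is degenerate if it has a representative $(\rho,\alpha)$ for which the first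 row of $\rho$ vanishes, i.e. $\rho=p$; then $\alpha\in P^+(\mathbb R)$ with this property is unique. *)

theory Defs
  imports
    "HOL-Analysis.Analysis"
    "HOL-Algebra.Group_Action"
    "HOL-Algebra.Elementary_Groups"
begin

section \<open>The ring of profinite integers\<close>

text \<open>
  The inverse limit of the rings \<open>\<int>/n\<int>\<close> for \<open>n \<ge> 1\<close> (ordered by divisibility): an element is the
  compatible family of its residues, each represented in \<open>{0..<n}\<close>. The case \<open>m = n\<close> of the
  compatibility condition enforces this range. The index \<open>0\<close> carries no information, so its entry
  is normalised to \<open>0\<close>.
\<close>

typedef zhat =
  "{f :: nat \<Rightarrow> int. f 0 = 0 \<and> (\<forall>n>0. \<forall>m. m dvd n \<longrightarrow> f n mod int m = f m)}"
  morphisms residue_of Abs_zhat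
  by (rule exI[of _ "\<lambda>_. 0"]) simp

setup_lifting type_definition_zhat

instantiation zhat :: comm_ring_1
begin

lift_definition zero_zhat :: zhat is "\<lambda>_. 0"
  by simp

lift_definition one_zhat :: zhat is "\<lambda>n. if n = 0 then 0 else 1 mod int n"
  by (auto simp: mod_mod_cancel)

lift_definition plus_zhat :: "zhat \<Rightarrow> zhat \<Rightarrow> zhat" is "\<lambda>f g n. (f n + g n) mod int n"
  by (auto simp: mod_mod_cancel) (metis mod_add_eq)

lift_definition times_zhat :: "zhat \<Rightarrow> zhat \<Rightarrow> zhat" is "\<lambda>f g n. (f n * g n) mod int n"
  by (auto simp: mod_mod_cancel) (metis mod_mult_eq)

lift_definition uminus_zhat :: "zhat \<Rightarrow> zhat" is "\<lambda>f n. (- f n) mod int n"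
  by (auto simp: mod_mod_cancel) (metis mod_minus_eq)

lift_definition minus_zhat :: "zhat \<Rightarrow> zhat \<Rightarrow> zhat" is "\<lambda>f g n. (f n - g n) mod int n"
  by (auto simp: mod_mod_cancel) (metis mod_diff_eq)

instance
proof
  fix a b c :: zhat
  show "a + b + c = a + (b + c)"
    by transfer (simp add: fun_eq_iff mod_simps add.assoc)
  show "a + b = b + a"
    by transfer (simp add: add.commute)
  show "0 + a = a"
    by transfer (auto simp: fun_eq_iff, metis bot_nat_0.not_eq_extremum dvd_refl mod_0)
  show "- a + a = 0"
    by transfer (simp add: fun_eq_iff mod_simps)
  show "a - b = a + - b"
    by transfer (simp add: fun_eq_iff mod_simps)
  show "a * b * c = a * (b * c)"
    by transfer (simp add: fun_eq_iff mod_simps mult.assoc)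
  show "a * b = b * a"
    by transfer (simp add: mult.commute)
  show "1 * a = a"
    by transfer (auto simp: fun_eq_iff mod_simps)
  show "(a + b) * c = a * c + b * c"
    by transfer (simp add: fun_eq_iff mod_simps distrib_right)
  show "(0 :: zhat) \<noteq> 1"
    by transfer (auto simp: fun_eq_iff intro!: exI[of _ 2])
qed

end


section \<open>Matrix groups\<close>

definition mat2 :: "'a::zero \<Rightarrow> 'a \<Rightarrow> 'a \<Rightarrow> 'a \<Rightarrow> 'a^2^2" where
  "mat2 a b c d = vector [vector [a, b], vector [c, d]]"

definition P_bar :: "('a::comm_ring_1^2^2) set" where
  "P_bar = {mat2 a b 0 1 | a b. True}"

definition P_group :: "('a::comm_ring_1^2^2) set" where
  "P_group = {mat2 a b 0 1 | a b. a dvd 1}"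

text \<open>Only used at the subrings \<open>\<int>\<close> and \<open>\<real>\<close> of the reals.\<close>

definition P_plus :: "('a::linordered_idom^2^2) set" where
  "P_plus = {A \<in> P_group. A $ 1 $ 1 > 0}"

definition GL2_plus :: "(real^2^2) set" where
  "GL2_plus = {A. det A > 0}"

definition SL2_Z :: "(int^2^2) set" where
  "SL2_Z = {A. det A = 1}"

text \<open>The embedding of the nonzero complex numbers into \<^term>\<open>GL2_plus\<close>.\<close>

definition cmat :: "complex \<Rightarrow> real^2^2" where
  "cmat w = mat2 (Re w) (Im w) (- Im w) (Re w)"

definition diag_act ::
    "int^2^2 \<Rightarrow> (zhat^2^2) \<times> (real^2^2) \<Rightarrow> (zhat^2^2) \<times> (real^2^2)" where
  "diag_act g = (\<lambda>(\<rho>, \<alpha>). (map_matrix of_int g ** \<rho>, map_matrix of_int g ** \<alpha>))"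


section \<open>Parabolic \<open>\<rat>\<close>-lattices and \<open>\<rat>\<close>-lattices up to scale\<close>

definition par_pairs :: "((zhat^2^2) \<times> (real^2^2)) set" where
  "par_pairs = P_bar \<times> P_plus"

definition par_rel :: "(((zhat^2^2) \<times> (real^2^2)) \<times> ((zhat^2^2) \<times> (real^2^2))) set" where
  "par_rel = {(u, v). u \<in> par_pairs \<and> v \<in> par_pairs \<and> (\<exists>g\<in>P_plus. v = diag_act g u)}"

definition parabolic_lattices :: "((zhat^2^2) \<times> (real^2^2)) set set" where
  "parabolic_lattices = par_pairs // par_rel"

definition lattice_pairs :: "((zhat^2^2) \<times> (real^2^2)) set" where
  "lattice_pairs = UNIV \<times> GL2_plus"

definition scale_rel :: "(((zhat^2^2) \<times> (real^2^2)) \<times> ((zhat^2^2) \<times> (real^2^2))) set" where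
  "scale_rel = {(u, v). u \<in> lattice_pairs \<and> v \<in> lattice_pairs \<and>
     (\<exists>g\<in>SL2_Z. \<exists>w. w \<noteq> 0 \<and> v = apsnd (\<lambda>\<alpha>. \<alpha> ** cmat w) (diag_act g u))}"

definition lattices_up_to_scale :: "((zhat^2^2) \<times> (real^2^2)) set set" where
  "lattices_up_to_scale = lattice_pairs // scale_rel"

text \<open>
  The map induced on classes by the inclusion of \<^term>\<open>par_pairs\<close> into \<^term>\<open>lattice_pairs\<close>. Since
  \<^term>\<open>par_rel\<close>-equivalent pairs are \<^term>\<open>scale_rel\<close>-equivalent, the union is over equal classes.
\<close>

definition \<theta> :: "((zhat^2^2) \<times> (real^2^2)) set \<Rightarrow> ((zhat^2^2) \<times> (real^2^2)) set" where
  "\<theta> X = (\<Union>u\<in>X. scale_rel `` {u})"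


section \<open>Degenerate parabolic \<open>\<rat>\<close>-lattices\<close>

definition p_mat :: "zhat^2^2" where
  "p_mat = mat2 0 0 0 1"

definition degenerate_lattices :: "((zhat^2^2) \<times> (real^2^2)) set set" where
  "degenerate_lattices = {X \<in> parabolic_lattices. \<exists>(\<rho>, \<alpha>)\<in>X. \<rho> $ 1 = 0}"

definition t_map :: "int \<Rightarrow> real^2^2 \<Rightarrow> real^2^2" where
  "t_map c \<alpha> = (let y = \<alpha> $ 1 $ 1; x = \<alpha> $ 1 $ 2; z = Complex x y in
     mat2 1 0 (of_int c) 1 ** \<alpha> ** matrix_inv (cmat (1 + of_int c * cnj z)))"

text \<open>
  \<open>\<tau> c\<close> is made extensional (undefined off the degenerate lattices), as the library's group actions
  require.
\<close>

definition \<tau> :: "int \<Rightarrow> ((zhat^2^2) \<times> (real^2^2)) set \<Rightarrow> ((zhat^2^2) \<times> (real^2^2)) set" where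
  "\<tau> c = (\<lambda>X\<in>degenerate_lattices. par_rel `` {(p_mat, t_map c (THE \<alpha>. (p_mat, \<alpha>) \<in> X))})"

end

theory Submission
  imports Defs
begin

text \<open>
  Read the two rows of a real matrix as complex numbers, the row \<open>(r, s)\<close> as \<open>s - ir\<close>. Then the right
  action of \<open>\<complex>\<^sup>\<times>\<close> is multiplication of both rows by a complex number, \<open>\<Gamma>\<close> forms integral
  combinations of the rows, and the parabolic matrix with entries \<open>y, x\<close> becomes the pair \<open>(u, 1)\<close>,
  where \<open>u = x - iy\<close> is a point of the lower half plane. A representative \<open>(\<rho>, \<alpha>)\<close> of a parabolic
  lattice is thus given by the first row \<open>(a, b)\<close> of \<open>\<rho>\<close> and by \<open>u\<close>, and the lattices of two
  representatives have the same image under \<open>\<theta>\<close> iff some matrix of \<open>\<Gamma>\<close> with rows \<open>(A, B)\<close>, \<open>(C, D)\<close> satisfies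
  \<open>a' = Aa\<close>, \<open>b' = Ab + B\<close>, \<open>Ca = 0\<close>, \<open>Cb + D = 1\<close> and \<open>u' = (Au + B) / (Cu + D)\<close>; the scaling factor
  is forced to be \<open>(Cu + D)\<^sup>-\<^sup>1\<close> because the second row has to be \<open>1\<close> again
  (lemma \<open>scale_rel_parabolic_pair\<close>).

  If \<open>C = 0\<close>, then \<open>A = D = 1\<close> and the matrix lies in \<open>P\<^sup>+(\<int>)\<close>: the parabolic lattices coincide. If
  \<open>C \<noteq> 0\<close>, then \<open>a = 0\<close> because the profinite integers are torsion free, and \<open>b\<close> is an ordinary integer
  because an integer divisible by \<open>C\<close> in the profinite integers is divisible by \<open>C\<close> in \<open>\<int>\<close>. A
  translation in \<open>P\<^sup>+(\<int>)\<close> then moves \<open>b\<close> to \<open>0\<close>, so both lattices are degenerate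
  (lemma \<open>theta_eq_imp_degenerate\<close>).

  A degenerate lattice has exactly one representative with \<open>a = b = 0\<close>, so these lattices are
  parametrised by the lower half plane. For two of them the conditions above force
  \<open>B = 0\<close> and \<open>A = D = 1\<close> and leave \<open>u' = u / (Cu + 1)\<close> with \<open>C\<close> arbitrary. This is the action \<open>\<tau>\<close>;
  in the coordinate \<open>1/u\<close> it is the translation by \<open>C\<close>, hence a free action, and its orbits are the
  fibres of \<open>\<theta>\<close>.
\<close>

section \<open>Integers inside the profinite integers\<close>

lemma residue_of_of_int: "residue_of (of_int k) n = (if n = 0 then 0 else k mod int n)"
proof -
  have nat_case: "residue_of (of_nat m) n = (if n = 0 then 0 else int m mod int n)" for m
    by (induction m) (auto simp: zero_zhat.rep_eq one_zhat.rep_eq plus_zhat.rep_eq mod_simps add.commute)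
  show ?thesis
  proof (cases "k \<ge> 0")
    case True
    then show ?thesis
      using nat_case[of "nat k"] by simp
  next
    case False
    then have "k = - int (nat (- k))"
      by simp
    then obtain m where "k = - int m"
      by blast
    then show ?thesis
      by (simp add: uminus_zhat.rep_eq nat_case mod_simps)
  qed
qed

lemma residue_of_mod: "n > 0 \<Longrightarrow> m dvd n \<Longrightarrow> residue_of a n mod int m = residue_of a m"
  using residue_of[of a] by blast

lemma residue_of_0 [simp]: "residue_of a 0 = 0"
  using residue_of[of a] by blast

text \<open>
  The residue of \<open>a\<close> modulo \<open>n\<close> is determined by its residue modulo \<open>n\<bar>k\<bar>\<close>, and \<open>ka = 0\<close> makes the
  latter a multiple of \<open>n\<close>.
\<close>

lemma zhat_torsion_free:
  assumes "of_int k * (a :: zhat) = 0" and "k \<noteq> 0"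
  shows "a = 0"
proof -
  have "residue_of a n = 0" if "n > 0" for n
  proof -
    define m where "m = n * nat \<bar>k\<bar>"
    have m: "m > 0" "int m = \<bar>int n * k\<bar>"
      using that assms(2) by (auto simp: m_def abs_mult)
    have "residue_of (of_int k * a) m = 0"
      using assms(1) by (simp add: zero_zhat.rep_eq)
    then have "(k * residue_of a m) mod int m = 0"
      using m(1) by (simp add: times_zhat.rep_eq residue_of_of_int mod_simps)
    then have "int n * k dvd residue_of a m * k"
      by (simp only: mod_eq_0_iff_dvd m(2) abs_dvd_iff mult.commute[of k])
    then have "int n dvd residue_of a m"
      using assms(2) by simp
    moreover have "residue_of a m mod int n = residue_of a n"
      using m(1) by (intro residue_of_mod) (auto simp: m_def)
    ultimately show ?thesis
      by simp
  qed
  then have "residue_of a = residue_of 0"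
    by (auto simp: fun_eq_iff zero_zhat.rep_eq) (metis neq0_conv residue_of_0)
  then show ?thesis
    by (simp add: residue_of_inject)
qed

instance zhat :: ring_char_0
proof
  show "inj (of_nat :: nat \<Rightarrow> zhat)"
  proof (rule injI, rule ccontr)
    fix m n :: nat
    assume "(of_nat m :: zhat) = of_nat n" and ne: "m \<noteq> n"
    then have "of_int (int m - int n) * (1 :: zhat) = 0"
      by simp
    then have "(1 :: zhat) = 0"
      by (rule zhat_torsion_free) (use ne in simp)
    then show False
      by simp
  qed
qed

text \<open>
  The residue modulo \<open>\<bar>k\<bar>\<close> shows that \<open>k\<close> divides \<open>l\<close> in the integers; the quotient is \<open>b\<close> because
  there is no torsion.
\<close>

lemma zhat_int_quotient:
  assumes "of_int k * (b :: zhat) = of_int l" and "k \<noteq> 0"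
  obtains m where "b = of_int m"
proof -
  define n where "n = nat \<bar>k\<bar>"
  have n: "n > 0" "int n = \<bar>k\<bar>"
    using assms(2) by (auto simp: n_def)
  have "residue_of (of_int k * b) n = 0"
    using n by (simp add: times_zhat.rep_eq residue_of_of_int mod_simps)
  then have "l mod \<bar>k\<bar> = 0"
    using n by (simp add: assms(1) residue_of_of_int)
  then obtain m where "l = k * m"
    by (auto simp: mod_eq_0_iff_dvd)
  then have "of_int k * (b - of_int m) = 0"
    using assms(1) by (simp add: algebra_simps)
  from zhat_torsion_free[OF this assms(2)] have "b = of_int m"
    by simp
  then show thesis
    by (rule that)
qed


section \<open>Matrices with complex rows\<close>

lemma mat2_nth [simp]:
  "mat2 a b c d $ 1 $ 1 = a" "mat2 a b c d $ 1 $ 2 = b"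
  "mat2 a b c d $ 2 $ 1 = c" "mat2 a b c d $ 2 $ 2 = d"
  by (simp_all add: mat2_def)

lemma mat2_eq_iff [simp]:
  "mat2 a b c d = mat2 a' b' c' d' \<longleftrightarrow> a = a' \<and> b = b' \<and> c = c' \<and> d = d'"
  by (metis mat2_nth)

lemma mat2_cases:
  obtains a b c d where "A = mat2 a b c d"
proof
  show "A = mat2 (A $ 1 $ 1) (A $ 1 $ 2) (A $ 2 $ 1) (A $ 2 $ 2)"
    by (simp add: vec_eq_iff forall_2)
qed

lemma mat2_mult [simp]:
  "mat2 a b c d ** mat2 a' b' c' d' =
     mat2 (a * a' + b * c') (a * b' + b * d') (c * a' + d * c') (c * b' + d * d')"
  by (simp add: vec_eq_iff forall_2 matrix_matrix_mult_def sum_2)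

lemma map_matrix_mat2 [simp]: "map_matrix f (mat2 a b c d) = mat2 (f a) (f b) (f c) (f d)"
  by (simp add: vec_eq_iff forall_2)

lemma det_mat2 [simp]: "det (mat2 a b c d) = a * d - b * c"
  by (simp add: det_2)

lemma mat_1_eq_mat2: "mat 1 = mat2 1 0 0 1"
  by (simp add: vec_eq_iff forall_2 mat_def)

lemma mat2_row_1_eq_0_iff [simp]: "mat2 a b c d $ 1 = 0 \<longleftrightarrow> a = 0 \<and> b = 0"
  by (simp add: vec_eq_iff forall_2)

lemma map_matrix_of_int_mat_1 [simp]:
  "map_matrix of_int (mat 1 :: int^2^2) = (mat 1 :: 'a::ring_1^2^2)"
  by (simp add: mat_1_eq_mat2)

lemma map_matrix_of_int_mult:
  "map_matrix of_int (g ** h) = (map_matrix of_int g ** map_matrix of_int h :: 'a::ring_1^2^2)"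
  for g h :: "int^2^2"
  by (cases g rule: mat2_cases; cases h rule: mat2_cases) simp

text \<open>
  The sign convention is the one for which scaling both rows is right multiplication by
  \<^const>\<open>cmat\<close>: the basis vectors \<open>e\<^sub>1 = 1\<close>, \<open>e\<^sub>2 = -i\<close> of the standard lattice are, in the reverse
  order, the rows of the identity matrix.
\<close>

definition complex_rows :: "complex \<Rightarrow> complex \<Rightarrow> real^2^2" where
  "complex_rows u v = mat2 (- Im u) (Re u) (- Im v) (Re v)"

lemma complex_rows_eq_iff [simp]: "complex_rows u v = complex_rows u' v' \<longleftrightarrow> u = u' \<and> v = v'"
  by (auto simp: complex_rows_def complex_eq_iff)

lemma complex_rows_mult_cmat [simp]:
  "complex_rows u v ** cmat w = complex_rows (u * w) (v * w)"
  by (simp add: complex_rows_def cmat_def algebra_simps)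

lemma mat2_mult_complex_rows:
  "mat2 (of_int a) (of_int b) (of_int c) (of_int d) ** complex_rows u v =
     complex_rows (of_int a * u + of_int b * v) (of_int c * u + of_int d * v)"
  by (simp add: complex_rows_def)

lemma cmat_mult: "cmat v ** cmat w = cmat (v * w)"
  by (simp add: cmat_def algebra_simps)

lemma cmat_1 [simp]: "cmat 1 = mat 1"
  by (simp add: cmat_def mat_1_eq_mat2)

lemma matrix_inv_cmat:
  assumes "w \<noteq> 0"
  shows "matrix_inv (cmat w) = cmat (inverse w)"
proof -
  have inv: "cmat w ** cmat (inverse w) = mat 1" "cmat (inverse w) ** cmat w = mat 1"
    using assms by (simp_all add: cmat_mult)
  then have "cmat w ** matrix_inv (cmat w) = mat 1"
    unfolding matrix_inv_def by (metis (mono_tags, lifting) someI_ex)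
  then have "cmat (inverse w) ** cmat w ** matrix_inv (cmat w) = cmat (inverse w)"
    by (simp add: matrix_mul_assoc[symmetric])
  then show ?thesis
    by (simp add: inv)
qed

lemma P_plus_int: "(P_plus :: (int^2^2) set) = {mat2 1 n 0 1 | n. True}"
  by (auto simp: P_plus_def P_group_def)

lemma P_plus_real: "P_plus = {complex_rows u 1 | u. Im u < 0}"
proof -
  have "\<exists>u. Im u < 0 \<and> mat2 a b 0 1 = complex_rows u 1" if "a > 0" for a b :: real
    using that by (intro exI[of _ "Complex b (- a)"]) (simp add: complex_rows_def)
  moreover have "complex_rows u 1 \<in> P_plus" if "Im u < 0" for u
    using that by (auto simp: P_plus_def P_group_def complex_rows_def dvd_field_iff)
  ultimately show ?thesis
    by (fastforce simp: P_plus_def P_group_def)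
qed


section \<open>Representatives and their equivalence\<close>

definition parabolic_pair :: "zhat \<Rightarrow> zhat \<Rightarrow> complex \<Rightarrow> (zhat^2^2) \<times> (real^2^2)" where
  "parabolic_pair a b u = (mat2 a b 0 1, complex_rows u 1)"

lemma par_pairs_eq: "par_pairs = {parabolic_pair a b u | a b u. Im u < 0}"
  by (auto simp: par_pairs_def P_bar_def P_plus_real parabolic_pair_def)

lemma par_pairs_subset_lattice_pairs: "par_pairs \<subseteq> lattice_pairs"
  by (auto simp: par_pairs_eq parabolic_pair_def complex_rows_def lattice_pairs_def GL2_plus_def)

definition scaled_act ::
    "int^2^2 \<Rightarrow> complex \<Rightarrow> (zhat^2^2) \<times> (real^2^2) \<Rightarrow> (zhat^2^2) \<times> (real^2^2)" where
  "scaled_act g w u = apsnd (\<lambda>\<alpha>. \<alpha> ** cmat w) (diag_act g u)"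

lemma scaled_act_one [simp]: "scaled_act (mat 1) 1 u = u"
  by (cases u) (simp add: scaled_act_def diag_act_def)

lemma scaled_act_scaled_act: "scaled_act g v (scaled_act h w u) = scaled_act (g ** h) (w * v) u"
  by (cases u)
    (simp add: scaled_act_def diag_act_def map_matrix_of_int_mult cmat_mult[symmetric] matrix_mul_assoc)

lemma diag_act_eq_scaled_act: "diag_act g = scaled_act g 1"
  by (simp add: fun_eq_iff scaled_act_def diag_act_def)

text \<open>
  The common form of the two relations on pairs: \<open>H\<close> is \<open>\<Gamma> \<times> \<complex>\<^sup>\<times>\<close> for lattices up to scale and
  \<open>P\<^sup>+(\<int>) \<times> {1}\<close> for parabolic lattices. Both ends of a related pair are required to lie in \<open>S\<close>, so
  the group laws of \<open>H\<close> are all that matters.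
\<close>

lemma equiv_scaled_act:
  assumes one: "(mat 1, 1) \<in> H"
    and mult: "\<And>g h v w. (g, v) \<in> H \<Longrightarrow> (h, w) \<in> H \<Longrightarrow> (g ** h, w * v) \<in> H"
    and inv: "\<And>g w. (g, w) \<in> H \<Longrightarrow> \<exists>g'. (g', inverse w) \<in> H \<and> w \<noteq> 0 \<and> g' ** g = mat 1"
  shows "equiv S {(u, v). u \<in> S \<and> v \<in> S \<and> (\<exists>(g, w)\<in>H. v = scaled_act g w u)}"
proof (rule equivI)
  let ?R = "{(u, v). u \<in> S \<and> v \<in> S \<and> (\<exists>(g, w)\<in>H. v = scaled_act g w u)}"
  show "?R \<subseteq> S \<times> S"
    by auto
  show "refl_on S ?R"
  proof (rule refl_onI)
    fix u
    assume "u \<in> S"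
    moreover have "u = scaled_act (mat 1) 1 u"
      by simp
    ultimately show "(u, u) \<in> ?R"
      using one by blast
  qed
  show "sym ?R"
  proof (rule symI)
    fix u v
    assume "(u, v) \<in> ?R"
    then obtain g w where gw: "(g, w) \<in> H" and "u \<in> S" "v \<in> S" and v: "v = scaled_act g w u"
      by blast
    from inv[OF gw] obtain g' where g': "(g', inverse w) \<in> H" "w \<noteq> 0" "g' ** g = mat 1"
      by blast
    then have "u = scaled_act g' (inverse w) v"
      by (simp add: v scaled_act_scaled_act)
    with g'(1) \<open>u \<in> S\<close> \<open>v \<in> S\<close> show "(v, u) \<in> ?R"
      by blast
  qed
  show "trans ?R"
  proof (rule transI)
    fix u v x
    assume "(u, v) \<in> ?R" "(v, x) \<in> ?R"
    then obtain g w h w' where "(g, w) \<in> H" "(h, w') \<in> H" "v = scaled_act g w u"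
      and "x = scaled_act h w' v" and "u \<in> S" "x \<in> S"
      by blast
    moreover from this have "x = scaled_act (h ** g) (w * w') u"
      by (simp add: scaled_act_scaled_act)
    ultimately show "(u, x) \<in> ?R"
      using mult by blast
  qed
qed

lemma equiv_scale_rel: "equiv lattice_pairs scale_rel"
proof -
  have "scale_rel = {(u, v). u \<in> lattice_pairs \<and> v \<in> lattice_pairs \<and>
      (\<exists>(g, w)\<in>SL2_Z \<times> (- {0}). v = scaled_act g w u)}"
    by (auto simp: scale_rel_def scaled_act_def)
  moreover have "equiv lattice_pairs \<dots>"
  proof (rule equiv_scaled_act)
    fix g :: "int^2^2" and w :: complex
    assume gw: "(g, w) \<in> SL2_Z \<times> (- {0})"
    obtain a b c d where g: "g = mat2 a b c d"
      by (rule mat2_cases)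
    \<comment> \<open>The adjugate is the inverse of a matrix of determinant one.\<close>
    have "(mat2 d (- b) (- c) a, inverse w) \<in> SL2_Z \<times> (- {0})"
      and "mat2 d (- b) (- c) a ** g = mat 1"
      using gw by (auto simp: g SL2_Z_def mat_1_eq_mat2 algebra_simps)
    then show "\<exists>g'. (g', inverse w) \<in> SL2_Z \<times> (- {0}) \<and> w \<noteq> 0 \<and> g' ** g = mat 1"
      using gw by auto
  qed (auto simp: SL2_Z_def det_mul)
  ultimately show ?thesis
    by simp
qed

lemma equiv_par_rel: "equiv par_pairs par_rel"
proof -
  have "par_rel = {(u, v). u \<in> par_pairs \<and> v \<in> par_pairs \<and>
      (\<exists>(g, w)\<in>P_plus \<times> {1}. v = scaled_act g w u)}"
    by (auto simp: par_rel_def diag_act_eq_scaled_act)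
  moreover have "equiv par_pairs \<dots>"
  proof (rule equiv_scaled_act)
    fix g :: "int^2^2" and w :: complex
    assume gw: "(g, w) \<in> P_plus \<times> {1}"
    then obtain n where "g = mat2 1 n 0 1"
      by (auto simp: P_plus_int)
    then have "(mat2 1 (- n) 0 1, inverse w) \<in> P_plus \<times> {1}" "mat2 1 (- n) 0 1 ** g = mat 1"
      using gw by (auto simp: P_plus_int mat_1_eq_mat2)
    then show "\<exists>g'. (g', inverse w) \<in> P_plus \<times> {1} \<and> w \<noteq> 0 \<and> g' ** g = mat 1"
      using gw by auto
  qed (auto simp: P_plus_int mat_1_eq_mat2)
  ultimately show ?thesis
    by simp
qed

lemma par_rel_subset_scale_rel: "par_rel \<subseteq> scale_rel"
proof (rule subrelI)
  fix u v
  assume "(u, v) \<in> par_rel"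
  then obtain g where "u \<in> par_pairs" "v \<in> par_pairs" "g \<in> P_plus" and v: "v = diag_act g u"
    by (auto simp: par_rel_def)
  moreover have "g \<in> SL2_Z"
    using \<open>g \<in> P_plus\<close> by (auto simp: P_plus_int SL2_Z_def)
  moreover have "v = apsnd (\<lambda>\<alpha>. \<alpha> ** cmat 1) (diag_act g u)"
    unfolding v by (cases "diag_act g u") simp
  moreover have "(1 :: complex) \<noteq> 0"
    by simp
  ultimately show "(u, v) \<in> scale_rel"
    using par_pairs_subset_lattice_pairs unfolding scale_rel_def mem_Collect_eq case_prod_conv
    by (intro conjI bexI[of _ g] exI[of _ 1]) auto
qed

lemma par_rel_parabolic_pair:
  assumes "Im u < 0"
  shows "(parabolic_pair a b u, v) \<in> par_rel \<longleftrightarrow>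
    (\<exists>n. v = parabolic_pair a (b + of_int n) (u + of_int n))"
proof -
  have "diag_act (mat2 1 n 0 1) (parabolic_pair a b u) =
      parabolic_pair a (b + of_int n) (u + of_int n)" for n
    using mat2_mult_complex_rows[of 1 n 0 1 u 1] by (simp add: diag_act_def parabolic_pair_def)
  moreover have "parabolic_pair a' b' v \<in> par_pairs" if "Im v < 0" for a' b' v
    using that by (auto simp: par_pairs_eq)
  ultimately show ?thesis
    using assms by (auto simp: par_rel_def P_plus_int)
qed

text \<open>
  The matrix with rows \<open>(A, B)\<close>, \<open>(C, D)\<close> sends the rows \<open>(u, 1)\<close> to \<open>(Au + B, Cu + D)\<close>. Scaling can
  turn the second of them into \<open>1\<close> in just one way, which leaves a Moebius transformation of \<open>u\<close>;
  \<open>Cu + D \<noteq> 0\<close> because \<open>u\<close> is not real.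
\<close>

lemma scale_rel_parabolic_pair:
  assumes "Im u < 0" and "Im u' < 0"
  shows "(parabolic_pair a b u, parabolic_pair a' b' u') \<in> scale_rel \<longleftrightarrow>
    (\<exists>A B C D. A * D - B * C = 1 \<and> a' = of_int A * a \<and> b' = of_int A * b + of_int B \<and>
       of_int C * a = 0 \<and> of_int C * b + of_int D = 1 \<and>
       u' * (of_int C * u + of_int D) = of_int A * u + of_int B)"
    (is "?lhs \<longleftrightarrow> (\<exists>A B C D. ?cond A B C D)")
proof -
  have in_pairs: "parabolic_pair a b u \<in> lattice_pairs" "parabolic_pair a' b' u' \<in> lattice_pairs"
    using assms par_pairs_subset_lattice_pairs by (auto simp: par_pairs_eq)
  have act: "apsnd (\<lambda>\<alpha>. \<alpha> ** cmat w) (diag_act (mat2 A B C D) (parabolic_pair a b u)) =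
      (mat2 (of_int A * a) (of_int A * b + of_int B) (of_int C * a) (of_int C * b + of_int D),
       complex_rows ((of_int A * u + of_int B) * w) ((of_int C * u + of_int D) * w))" for w A B C D
    using mat2_mult_complex_rows[of A B C D u 1] by (simp add: diag_act_def parabolic_pair_def)
  show ?thesis
  proof
    assume ?lhs
    then obtain g w where "g \<in> SL2_Z" "w \<noteq> 0"
      and eq: "parabolic_pair a' b' u' = apsnd (\<lambda>\<alpha>. \<alpha> ** cmat w) (diag_act g (parabolic_pair a b u))"
      by (auto simp: scale_rel_def)
    moreover obtain A B C D where "g = mat2 A B C D"
      by (rule mat2_cases)
    ultimately have pair: "parabolic_pair a' b' u' =
        (mat2 (of_int A * a) (of_int A * b + of_int B) (of_int C * a) (of_int C * b + of_int D),
         complex_rows ((of_int A * u + of_int B) * w) ((of_int C * u + of_int D) * w))"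
      and det: "A * D - B * C = 1"
      using act[of w A B C D] by (simp_all add: SL2_Z_def)
    then have u': "u' = (of_int A * u + of_int B) * w" and w: "(of_int C * u + of_int D) * w = 1"
      by (simp_all add: parabolic_pair_def)
    have "u' * (of_int C * u + of_int D) =
        (of_int A * u + of_int B) * ((of_int C * u + of_int D) * w)"
      by (simp only: u' ac_simps)
    also have "\<dots> = of_int A * u + of_int B"
      by (simp only: w mult_1_right)
    finally have "?cond A B C D"
      using pair det unfolding parabolic_pair_def prod.inject mat2_eq_iff by metis
    then show "\<exists>A B C D. ?cond A B C D"
      by blast
  next
    assume "\<exists>A B C D. ?cond A B C D"
    then obtain A B C D where det: "A * D - B * C = 1"
      and \<rho>: "a' = of_int A * a" "b' = of_int A * b + of_int B"
        "of_int C * a = 0" "of_int C * b + of_int D = 1"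
      and mob: "u' * (of_int C * u + of_int D) = of_int A * u + of_int B"
      by blast
    define q where "q = of_int C * u + of_int D"
    have "q \<noteq> 0"
    proof
      assume "q = 0"
      then have "C = 0" "D = 0"
        using assms(1) by (auto simp: q_def complex_eq_iff)
      with det show False
        by simp
    qed
    have "u' * q = of_int A * u + of_int B"
      using mob by (simp only: q_def)
    then have u': "u' = (of_int A * u + of_int B) * inverse q"
      using \<open>q \<noteq> 0\<close> by (metis mult.assoc mult.right_neutral right_inverse)
    have "parabolic_pair a' b' u' =
        apsnd (\<lambda>\<alpha>. \<alpha> ** cmat (inverse q)) (diag_act (mat2 A B C D) (parabolic_pair a b u))"
      unfolding act q_def[symmetric]
      using \<rho> u' \<open>q \<noteq> 0\<close> by (simp add: parabolic_pair_def)
    moreover have "mat2 A B C D \<in> SL2_Z"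
      using det by (simp add: SL2_Z_def)
    moreover have "inverse q \<noteq> 0"
      using \<open>q \<noteq> 0\<close> by simp
    ultimately show ?lhs
      unfolding scale_rel_def mem_Collect_eq case_prod_conv using in_pairs by blast
  qed
qed


section \<open>Injectivity off the degenerate lattices\<close>

lemma theta_class:
  assumes "u \<in> par_pairs"
  shows "\<theta> (par_rel `` {u}) = scale_rel `` {u}"
proof -
  have "scale_rel `` {v} = scale_rel `` {u}" if "v \<in> par_rel `` {u}" for v
    using that par_rel_subset_scale_rel equiv_class_eq[OF equiv_scale_rel, of u v] by auto
  moreover have "u \<in> par_rel `` {u}"
    using equiv_class_self[OF equiv_par_rel assms] .
  ultimately show ?thesis
    unfolding \<theta>_def by blast
qed

lemma theta_eq_iff:
  assumes "u \<in> par_pairs" "v \<in> par_pairs"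
  shows "\<theta> (par_rel `` {u}) = \<theta> (par_rel `` {v}) \<longleftrightarrow> (u, v) \<in> scale_rel"
proof -
  have "u \<in> lattice_pairs" "v \<in> lattice_pairs"
    using assms par_pairs_subset_lattice_pairs by auto
  then show ?thesis
    by (simp only: assms theta_class eq_equiv_class_iff[OF equiv_scale_rel])
qed

lemma parabolic_lattice_cases:
  assumes "X \<in> parabolic_lattices"
  obtains a b u where "Im u < 0" "X = par_rel `` {parabolic_pair a b u}"
  using assms unfolding parabolic_lattices_def par_pairs_eq by (auto elim!: quotientE)

text \<open>
  The translation by \<open>- n\<close> in \<open>P\<^sup>+(\<int>)\<close> makes the first row of \<open>\<rho>\<close> vanish.
\<close>

lemma degenerate_class:
  assumes "Im u < 0"
  shows "par_rel `` {parabolic_pair 0 (of_int n) u} \<in> degenerate_lattices"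
proof -
  have "parabolic_pair 0 (of_int n) u \<in> par_pairs"
    using assms by (auto simp: par_pairs_eq)
  moreover have "parabolic_pair 0 0 (u - of_int n) \<in> par_rel `` {parabolic_pair 0 (of_int n) u}"
    using assms by (auto simp: par_rel_parabolic_pair intro: exI[of _ "- n"])
  ultimately show ?thesis
    unfolding degenerate_lattices_def parabolic_lattices_def
    by (auto simp: parabolic_pair_def intro!: quotientI bexI[rotated])
qed

text \<open>
  The lower left entry \<open>C\<close> of the matrix relating the representatives decides: for \<open>C = 0\<close> the matrix
  is a translation, and for \<open>C \<noteq> 0\<close> the second row \<open>(0, 1)\<close> of \<open>\<rho>\<close> can only be preserved if \<open>a = 0\<close>
  and \<open>b\<close> is an integer.
\<close>

lemma theta_eq_imp_degenerate:
  assumes "X \<in> parabolic_lattices" "Y \<in> parabolic_lattices" and eq: "\<theta> X = \<theta> Y"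
  shows "X = Y \<or> X \<in> degenerate_lattices \<and> Y \<in> degenerate_lattices"
proof -
  obtain a b u where u: "Im u < 0" and X: "X = par_rel `` {parabolic_pair a b u}"
    using assms(1) by (rule parabolic_lattice_cases)
  obtain a' b' u' where u': "Im u' < 0" and Y: "Y = par_rel `` {parabolic_pair a' b' u'}"
    using assms(2) by (rule parabolic_lattice_cases)
  have "(parabolic_pair a b u, parabolic_pair a' b' u') \<in> scale_rel"
    using eq u u' by (subst theta_eq_iff[symmetric]) (auto simp: X Y par_pairs_eq)
  then obtain A B C D where det: "A * D - B * C = 1"
    and a': "a' = of_int A * a" and b': "b' = of_int A * b + of_int B"
    and Ca: "of_int C * a = 0" and Cb: "of_int C * b + of_int D = 1"
    and mob: "u' * (of_int C * u + of_int D) = of_int A * u + of_int B"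
    using u u' by (auto simp: scale_rel_parabolic_pair)
  show ?thesis
  proof (cases "C = 0")
    case True
    then have "D = 1"
      using Cb by simp
    then have "A = 1"
      using det True by simp
    have "parabolic_pair a' b' u' = parabolic_pair a (b + of_int B) (u + of_int B)"
      using a' b' mob True \<open>D = 1\<close> \<open>A = 1\<close> by simp
    then have "(parabolic_pair a b u, parabolic_pair a' b' u') \<in> par_rel"
      using u by (auto simp: par_rel_parabolic_pair)
    then show ?thesis
      unfolding X Y by (intro disjI1 equiv_class_eq[OF equiv_par_rel])
  next
    case False
    have "a = 0"
      using Ca False by (rule zhat_torsion_free)
    have "of_int C * b = of_int (1 - D)"
      using Cb by (simp add: algebra_simps)
    then obtain m where m: "b = of_int m"
      using False by (rule zhat_int_quotient)
    have "a' = 0" "b' = of_int (A * m + B)"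
      using \<open>a = 0\<close> a' b' m by simp_all
    then show ?thesis
      using \<open>a = 0\<close> m u u' degenerate_class by (simp add: X Y del: of_int_add of_int_mult)
  qed
qed


section \<open>The action on the degenerate lattices\<close>

definition degenerate_lattice :: "complex \<Rightarrow> ((zhat^2^2) \<times> (real^2^2)) set" where
  "degenerate_lattice u = par_rel `` {(p_mat, complex_rows u 1)}"

lemma degenerate_lattice_eq: "degenerate_lattice u = par_rel `` {parabolic_pair 0 0 u}"
  by (simp add: degenerate_lattice_def parabolic_pair_def p_mat_def)

lemma degenerate_lattice_mem:
  assumes "Im u < 0"
  shows "degenerate_lattice u \<in> degenerate_lattices"
  using degenerate_class[OF assms, of 0] by (simp add: degenerate_lattice_eq)

lemma degenerate_lattice_cases:
  assumes "X \<in> degenerate_lattices"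
  obtains u where "Im u < 0" "X = degenerate_lattice u"
proof -
  from assms obtain \<rho> \<alpha> where X: "X \<in> par_pairs // par_rel" and mem: "(\<rho>, \<alpha>) \<in> X" and "\<rho> $ 1 = 0"
    by (auto simp: degenerate_lattices_def parabolic_lattices_def)
  have "(\<rho>, \<alpha>) \<in> par_pairs"
    using X mem equiv_par_rel in_quotient_imp_subset by blast
  then obtain u where "Im u < 0" and eq: "(\<rho>, \<alpha>) = parabolic_pair 0 0 u"
    using \<open>\<rho> $ 1 = 0\<close> by (auto simp: par_pairs_eq parabolic_pair_def)
  moreover have "X = par_rel `` {parabolic_pair 0 0 u}"
    using quotient_eq_iff[OF equiv_par_rel X quotientI, of "(\<rho>, \<alpha>)" "(\<rho>, \<alpha>)" "(\<rho>, \<alpha>)"] mem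
      \<open>(\<rho>, \<alpha>) \<in> par_pairs\<close> equiv_class_self[OF equiv_par_rel, of "(\<rho>, \<alpha>)"] equiv_par_rel
    by (auto simp: eq equiv_def refl_on_def)
  ultimately show thesis
    using that by (simp add: degenerate_lattice_eq)
qed

lemma mem_degenerate_lattice_iff:
  assumes "Im u < 0"
  shows "(p_mat, \<alpha>) \<in> degenerate_lattice u \<longleftrightarrow> \<alpha> = complex_rows u 1"
  using assms
  by (auto simp: degenerate_lattice_eq par_rel_parabolic_pair) (auto simp: parabolic_pair_def p_mat_def)

lemma degenerate_lattice_inject:
  assumes "Im u < 0" "Im v < 0" "degenerate_lattice u = degenerate_lattice v"
  shows "u = v"
  using mem_degenerate_lattice_iff[OF assms(1), of "complex_rows u 1"]
    mem_degenerate_lattice_iff[OF assms(2), of "complex_rows u 1"] assms(3)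
  by simp

text \<open>
  The Moebius transformation \<open>u / (cu + 1)\<close>, written as the translation by \<open>c\<close> in the coordinate
  \<open>1/u\<close>; in this form the group law and the freeness are those of addition.
\<close>

definition lower_shear :: "int \<Rightarrow> complex \<Rightarrow> complex" where
  "lower_shear c u = inverse (inverse u + of_int c)"

lemma Im_inverse_pos_iff: "Im (inverse u) > 0 \<longleftrightarrow> Im u < 0"
  by (cases "u = 0") (auto simp: complex_eq_iff divide_less_0_iff zero_less_divide_iff sum_power2_gt_zero_iff not_sum_power2_lt_zero)

lemma Im_lower_shear_neg: "Im u < 0 \<Longrightarrow> Im (lower_shear c u) < 0"
  by (subst Im_inverse_pos_iff[symmetric])
    (simp add: lower_shear_def Im_inverse_pos_iff del: inverse_complex.sel)

lemma lower_shear_0 [simp]: "lower_shear 0 u = u"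
  by (simp add: lower_shear_def)

lemma lower_shear_add: "lower_shear (c + d) u = lower_shear c (lower_shear d u)"
  by (simp add: lower_shear_def algebra_simps)

lemma lower_shear_fixed_iff: "lower_shear c u = u \<longleftrightarrow> c = 0"
  unfolding lower_shear_def by (metis add_cancel_right_right inverse_inverse_eq of_int_eq_0_iff)

lemma one_plus_int_mult_nonzero: "Im u < 0 \<Longrightarrow> 1 + of_int c * u \<noteq> 0"
  by (auto simp: complex_eq_iff)

lemma lower_shear_mult:
  assumes "Im u < 0"
  shows "v * (of_int c * u + 1) = u \<longleftrightarrow> v = lower_shear c u"
proof -
  have "u \<noteq> 0" "1 + of_int c * u \<noteq> 0"
    using assms one_plus_int_mult_nonzero by auto
  then show ?thesis
    by (simp add: lower_shear_def field_simps)
qed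

text \<open>
  Adding \<open>c\<close> times the first row to the second turns \<open>(u, 1)\<close> into \<open>(u, 1 + cu)\<close>. The conjugate in
  \<^const>\<open>t_map\<close> is accounted for by \<open>u\<close> being the conjugate of \<open>z\<close>.
\<close>

lemma t_map_complex_rows:
  assumes "Im u < 0"
  shows "t_map c (complex_rows u 1) = complex_rows (lower_shear c u) 1"
proof -
  define q where "q = 1 + of_int c * u"
  have "q \<noteq> 0"
    using assms by (simp add: q_def one_plus_int_mult_nonzero)
  have "cnj (Complex (complex_rows u 1 $ 1 $ 2) (complex_rows u 1 $ 1 $ 1)) = u"
    by (simp add: complex_rows_def complex_eq_iff)
  then have "t_map c (complex_rows u 1) =
      mat2 1 0 (of_int c) 1 ** complex_rows u 1 ** matrix_inv (cmat q)"
    by (simp add: t_map_def q_def Let_def)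
  also have "\<dots> = complex_rows u q ** cmat (inverse q)"
    using mat2_mult_complex_rows[of 1 0 c 1 u 1] \<open>q \<noteq> 0\<close>
    by (simp add: matrix_inv_cmat q_def add.commute)
  also have "\<dots> = complex_rows (lower_shear c u) 1"
    using \<open>q \<noteq> 0\<close> lower_shear_mult[OF assms, of "u * inverse q" c]
    by (simp add: q_def add.commute)
  finally show ?thesis .
qed

lemma tau_degenerate_lattice:
  assumes "Im u < 0"
  shows "\<tau> c (degenerate_lattice u) = degenerate_lattice (lower_shear c u)"
  using assms
  by (simp add: \<tau>_def degenerate_lattice_mem mem_degenerate_lattice_iff t_map_complex_rows)
    (simp add: degenerate_lattice_def)

lemma tau_closed: "X \<in> degenerate_lattices \<Longrightarrow> \<tau> c X \<in> degenerate_lattices"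
  by (erule degenerate_lattice_cases)
    (simp add: tau_degenerate_lattice degenerate_lattice_mem Im_lower_shear_neg)

lemma tau_0: "X \<in> degenerate_lattices \<Longrightarrow> \<tau> 0 X = X"
  by (erule degenerate_lattice_cases) (simp add: tau_degenerate_lattice)

lemma tau_add: "X \<in> degenerate_lattices \<Longrightarrow> \<tau> (c + d) X = \<tau> c (\<tau> d X)"
  by (erule degenerate_lattice_cases)
    (simp add: tau_degenerate_lattice Im_lower_shear_neg lower_shear_add)

lemma group_action_tau: "group_action integer_group degenerate_lattices \<tau>"
proof -
  have Bij: "\<tau> c \<in> Bij degenerate_lattices" for c
  proof -
    have "bij_betw (\<tau> c) degenerate_lattices degenerate_lattices"
      by (rule bij_betw_byWitness[where f' = "\<tau> (- c)"])
        (auto simp: tau_closed tau_0 tau_add[symmetric])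
    then show ?thesis
      by (simp add: Bij_def \<tau>_def)
  qed
  have "\<tau> (c + d) = compose degenerate_lattices (\<tau> c) (\<tau> d)" for c d
  proof (rule extensionalityI)
    show "\<tau> (c + d) \<in> extensional degenerate_lattices"
      by (simp add: \<tau>_def)
  qed (auto simp: compose_def tau_add)
  with Bij have "\<tau> \<in> hom integer_group (BijGroup degenerate_lattices)"
    by (auto simp: hom_def BijGroup_def)
  then show ?thesis
    by (simp add: group_action_def group_hom_def group_hom_axioms_def group_BijGroup)
qed

lemma stabilizer_tau:
  assumes "X \<in> degenerate_lattices"
  shows "stabilizer integer_group \<tau> X = {\<one>\<^bsub>integer_group\<^esub>}"
proof -
  obtain u where u: "Im u < 0" "X = degenerate_lattice u"
    using assms by (rule degenerate_lattice_cases)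
  have "\<tau> c X = X \<longleftrightarrow> c = 0" for c
    using degenerate_lattice_inject[OF Im_lower_shear_neg[OF u(1)] u(1), of c] lower_shear_fixed_iff
    by (auto simp: u tau_degenerate_lattice)
  then show ?thesis
    by (auto simp: stabilizer_def)
qed

text \<open>
  When both first rows vanish, the criterion for equal images forces \<open>B = 0\<close> and \<open>D = 1\<close>, hence
  \<open>A = 1\<close>, and puts no condition on \<open>C\<close>.
\<close>

lemma theta_degenerate_lattice_eq_iff:
  assumes "Im u < 0" "Im v < 0"
  shows "\<theta> (degenerate_lattice u) = \<theta> (degenerate_lattice v) \<longleftrightarrow> (\<exists>c. v = lower_shear c u)"
proof -
  have "\<theta> (degenerate_lattice u) = \<theta> (degenerate_lattice v) \<longleftrightarrow>
      (parabolic_pair 0 0 u, parabolic_pair 0 0 v) \<in> scale_rel"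
    unfolding degenerate_lattice_eq using assms by (intro theta_eq_iff) (auto simp: par_pairs_eq)
  also have "\<dots> \<longleftrightarrow> (\<exists>c. v * (of_int c * u + 1) = u)"
    unfolding scale_rel_parabolic_pair[OF assms]
  proof safe
    fix A B C D :: int
    assume "A * D - B * C = 1" "(0::zhat) = of_int A * 0 + of_int B" "of_int C * (0::zhat) + of_int D = 1"
      and "v * (of_int C * u + of_int D) = of_int A * u + of_int B"
    then have "v * (of_int C * u + 1) = u"
      by auto
    then show "\<exists>c. v * (of_int c * u + 1) = u"
      by blast
  next
    fix c :: int
    assume "v * (of_int c * u + 1) = u"
    then show "\<exists>A B C D. A * D - B * C = 1 \<and> (0::zhat) = of_int A * 0 \<and>
        (0::zhat) = of_int A * 0 + of_int B \<and> of_int C * (0::zhat) = 0 \<and>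
        of_int C * (0::zhat) + of_int D = 1 \<and>
        v * (of_int C * u + of_int D) = of_int A * u + of_int B"
      by (intro exI[of _ 1] exI[of _ 0] exI[of _ c]) simp
  qed
  finally show ?thesis
    by (simp add: lower_shear_mult[OF assms(1)])
qed

lemma orbit_tau:
  assumes "X \<in> degenerate_lattices"
  shows "orbit integer_group \<tau> X = {Y \<in> degenerate_lattices. \<theta> Y = \<theta> X}"
proof -
  obtain u where u: "Im u < 0" "X = degenerate_lattice u"
    using assms by (rule degenerate_lattice_cases)
  have orbit: "orbit integer_group \<tau> X = {degenerate_lattice (lower_shear c u) | c. True}"
    using u by (simp add: orbit_def tau_degenerate_lattice)
  show ?thesis
  proof (rule Set.set_eqI)
    fix Y
    show "Y \<in> orbit integer_group \<tau> X \<longleftrightarrow> Y \<in> {Y \<in> degenerate_lattices. \<theta> Y = \<theta> X}"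
    proof
      assume "Y \<in> orbit integer_group \<tau> X"
      then obtain c where "Y = degenerate_lattice (lower_shear c u)"
        by (auto simp: orbit)
      moreover have "\<theta> X = \<theta> (degenerate_lattice (lower_shear c u))"
        using u by (auto simp: theta_degenerate_lattice_eq_iff Im_lower_shear_neg)
      ultimately show "Y \<in> {Y \<in> degenerate_lattices. \<theta> Y = \<theta> X}"
        using u by (simp add: degenerate_lattice_mem Im_lower_shear_neg)
    next
      assume Y: "Y \<in> {Y \<in> degenerate_lattices. \<theta> Y = \<theta> X}"
      then obtain v where v: "Im v < 0" "Y = degenerate_lattice v"
        by (blast elim: degenerate_lattice_cases)
      then have "\<theta> (degenerate_lattice u) = \<theta> (degenerate_lattice v)"
        using Y u by simp
      then show "Y \<in> orbit integer_group \<tau> X"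
        unfolding orbit using u v by (auto simp: theta_degenerate_lattice_eq_iff)
    qed
  qed
qed

theorem proposition6p2:
  shows
    "\<theta> \<in> parabolic_lattices \<rightarrow> lattices_up_to_scale \<and>
     (\<forall>u\<in>par_pairs. \<theta> (par_rel `` {u}) = scale_rel `` {u}) \<and>
     (\<forall>X\<in>parabolic_lattices. \<forall>Y\<in>parabolic_lattices.
        \<theta> X = \<theta> Y \<longrightarrow> X = Y \<or> X \<in> degenerate_lattices \<and> Y \<in> degenerate_lattices) \<and>
     (\<forall>c. \<forall>\<alpha>\<in>P_plus. \<tau> c (par_rel `` {(p_mat, \<alpha>)}) = par_rel `` {(p_mat, t_map c \<alpha>)}) \<and>
     group_action integer_group degenerate_lattices \<tau> \<and>
     (\<forall>X\<in>degenerate_lattices. stabilizer integer_group \<tau> X = {\<one>\<^bsub>integer_group\<^esub>}) \<and>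
     (\<forall>X\<in>degenerate_lattices.
        orbit integer_group \<tau> X = {Y \<in> degenerate_lattices. \<theta> Y = \<theta> X})"
proof (intro conjI ballI allI impI)
  show "\<theta> \<in> parabolic_lattices \<rightarrow> lattices_up_to_scale"
    using par_pairs_subset_lattice_pairs
    by (auto simp: parabolic_lattices_def lattices_up_to_scale_def theta_class
        elim!: quotientE intro!: quotientI)
  fix c and \<alpha> :: "real^2^2"
  assume "\<alpha> \<in> P_plus"
  then obtain u where "\<alpha> = complex_rows u 1" "Im u < 0"
    by (auto simp: P_plus_real)
  then show "\<tau> c (par_rel `` {(p_mat, \<alpha>)}) = par_rel `` {(p_mat, t_map c \<alpha>)}"
    using tau_degenerate_lattice[of u c] by (simp add: t_map_complex_rows degenerate_lattice_def)
qed (simp_all add: theta_class theta_eq_imp_degenerate group_action_tau stabilizer_tau orbit_tau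
    del: one_integer_group)

end
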